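(* For any countable language $\mathcal{L}$, the isomorphism relation on $\mathsf{Mod}(\mathcal{L})$ is Borel graphable by a Borel graph of diameter $2$.
   Context: $\mathsf{Mod}(\mathcal{L})$ is the standard Polish space of $\mathcal{L}$-structures with universe $\mathbb{N}$. An equivalence relation $E$ on a Polish space $X$ is Borel graphable (by $G$) if $G$ is a Borel graph on $X$ whose connectedness relation ($x,y$ related iff a finite path in $G$ joins them) equals $E$. The diameter of a graph is the maximum distance between any two vertices that are connected.
   Formalization: If all symbols of the language are relation symbols of arity 0 (e.g. the empty language), isomorphism is equality and every graphing has diameter 0; the diameter is therefore shown to be at most 2 for every countable language, and exactly 2 for all languages not of this kind. *)

theory Defs
  imports "HOL-Analysis.Analysis" "HOL-Library.Extended_Nat"
begin

section \<open>Borel graphable equivalence relations\<close>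

definition borel_sets_of :: "'a topology \<Rightarrow> 'a set set" where
  "borel_sets_of X = sigma_sets (topspace X) {U. openin X U}"

definition borel_graph_on :: "'a topology \<Rightarrow> ('a \<times> 'a) set \<Rightarrow> bool" where
  "borel_graph_on X G \<longleftrightarrow> G \<in> borel_sets_of (prod_topology X X) \<and> sym G \<and> irrefl G"

text \<open>
  A vertex is joined to itself by the path of length 0, so the reflexive-transitive closure is
  restricted to the vertex set \<open>V\<close>.
\<close>

definition connectedness_rel :: "'a set \<Rightarrow> ('a \<times> 'a) set \<Rightarrow> ('a \<times> 'a) set" where
  "connectedness_rel V G = {(x, y). x \<in> V \<and> y \<in> V \<and> (x, y) \<in> G\<^sup>*}"

definition borel_graphable_by :: "'a topology \<Rightarrow> ('a \<times> 'a) set \<Rightarrow> ('a \<times> 'a) set \<Rightarrow> bool" where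
  "borel_graphable_by X E G \<longleftrightarrow> borel_graph_on X G \<and> connectedness_rel (topspace X) G = E"

text \<open>Only meaningful when \<open>x\<close> and \<open>y\<close> are joined by a path.\<close>

definition graph_distance :: "('a \<times> 'a) set \<Rightarrow> 'a \<Rightarrow> 'a \<Rightarrow> nat" where
  "graph_distance G x y = (LEAST n. (x, y) \<in> G ^^ n)"

definition graph_diameter :: "'a set \<Rightarrow> ('a \<times> 'a) set \<Rightarrow> enat" where
  "graph_diameter V G = (SUP (x, y) \<in> connectedness_rel V G. enat (graph_distance G x y))"


section \<open>Structures with universe the natural numbers\<close>

text \<open>Constants are function symbols of arity 0.\<close>

record ('r, 'f) language =
  Rels :: "'r set"
  Funs :: "'f set"
  rel_arity :: "'r \<Rightarrow> nat"
  fun_arity :: "'f \<Rightarrow> nat"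

definition countable_language :: "('r, 'f) language \<Rightarrow> bool" where
  "countable_language L \<longleftrightarrow> countable (Rels L) \<and> countable (Funs L)"

definition tuples :: "nat \<Rightarrow> nat list set" where
  "tuples n = {xs. length xs = n}"

text \<open>
  A structure is a pair of interpretations, of the relation symbols and of the function symbols.
  These are extensional functions, so that equality of structures is equality of the
  interpretations on the symbols of the language and the tuples of the right length.
\<close>

type_synonym ('r, 'f) nat_structure =
  "('r \<Rightarrow> nat list \<Rightarrow> bool) \<times> ('f \<Rightarrow> nat list \<Rightarrow> nat)"

definition Mod :: "('r, 'f) language \<Rightarrow> ('r, 'f) nat_structure set" where
  "Mod L =
     (\<Pi>\<^sub>E R\<in>Rels L. \<Pi>\<^sub>E xs\<in>tuples (rel_arity L R). UNIV) \<times>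
     (\<Pi>\<^sub>E F\<in>Funs L. \<Pi>\<^sub>E xs\<in>tuples (fun_arity L F). UNIV)"

definition Mod_topology :: "('r, 'f) language \<Rightarrow> ('r, 'f) nat_structure topology" where
  "Mod_topology L =
     prod_topology
       (product_topology
          (\<lambda>R. product_topology (\<lambda>xs. discrete_topology UNIV) (tuples (rel_arity L R)))
          (Rels L))
       (product_topology
          (\<lambda>F. product_topology (\<lambda>xs. discrete_topology UNIV) (tuples (fun_arity L F)))
          (Funs L))"

lemma topspace_Mod_topology [simp]: "topspace (Mod_topology L) = Mod L"
  by (simp add: Mod_topology_def Mod_def)

definition is_isomorphism ::
  "('r, 'f) language \<Rightarrow> (nat \<Rightarrow> nat) \<Rightarrow> ('r, 'f) nat_structure \<Rightarrow> ('r, 'f) nat_structure \<Rightarrow> bool"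
where
  "is_isomorphism L \<pi> M N \<longleftrightarrow>
     bij \<pi> \<and>
     (\<forall>R\<in>Rels L. \<forall>xs\<in>tuples (rel_arity L R). fst M R xs \<longleftrightarrow> fst N R (map \<pi> xs)) \<and>
     (\<forall>F\<in>Funs L. \<forall>xs\<in>tuples (fun_arity L F). \<pi> (snd M F xs) = snd N F (map \<pi> xs))"

definition isomorphism_rel ::
  "('r, 'f) language \<Rightarrow> (('r, 'f) nat_structure \<times> ('r, 'f) nat_structure) set" where
  "isomorphism_rel L = {(M, N). M \<in> Mod L \<and> N \<in> Mod L \<and> (\<exists>\<pi>. is_isomorphism L \<pi> M N)}"

lemma is_isomorphism_id: "is_isomorphism L id M M"
  by (simp add: is_isomorphism_def)

lemma is_isomorphism_comp:
  assumes "is_isomorphism L \<pi> M N" "is_isomorphism L \<rho> N K"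
  shows "is_isomorphism L (\<rho> \<circ> \<pi>) M K"
  using assms by (auto simp: is_isomorphism_def tuples_def bij_comp)

lemma is_isomorphism_inv:
  assumes "is_isomorphism L \<pi> M N"
  shows "is_isomorphism L (inv \<pi>) N M"
proof -
  have b: "bij \<pi>" using assms by (simp add: is_isomorphism_def)
  have m: "map \<pi> (map (inv \<pi>) xs) = xs" for xs
    using b by (simp add: bij_is_surj surj_iff[THEN iffD1])
  have "fst N R xs \<longleftrightarrow> fst M R (map (inv \<pi>) xs)"
    if "R \<in> Rels L" "xs \<in> tuples (rel_arity L R)" for R xs
    using assms that m[of xs] by (auto simp: is_isomorphism_def tuples_def simp del: map_map)
  moreover have "inv \<pi> (snd N F xs) = snd M F (map (inv \<pi>) xs)"
    if "F \<in> Funs L" "xs \<in> tuples (fun_arity L F)" for F xs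
  proof -
    have "\<pi> (snd M F (map (inv \<pi>) xs)) = snd N F xs"
      using assms that m[of xs] by (auto simp: is_isomorphism_def tuples_def simp del: map_map)
    then show ?thesis by (metis b bij_inv_eq_iff)
  qed
  ultimately show ?thesis
    using b by (simp add: is_isomorphism_def bij_imp_bij_inv)
qed

lemma equiv_isomorphism_rel: "equiv (Mod L) (isomorphism_rel L)"
  by (rule equivI)
     (auto simp: isomorphism_rel_def refl_on_def sym_def trans_def
        intro: is_isomorphism_id is_isomorphism_inv is_isomorphism_comp)

text \<open>
  If the only symbols are relation symbols of arity 0, isomorphic structures are equal, and every
  graph with connectedness relation the isomorphism relation has diameter 0.
\<close>

definition propositional_language :: "('r, 'f) language \<Rightarrow> bool" where
  "propositional_language L \<longleftrightarrow> Funs L = {} \<and> (\<forall>R\<in>Rels L. rel_arity L R = 0)"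

end

theory Submission
  imports Defs
begin

text \<open>
  Let \<open>f\<close> be an isomorphism from \<open>M\<close> to \<open>N\<close>. If all permutations fixing some finite set
  pointwise are automorphisms of \<open>M\<close>, then \<open>f\<close> may be taken of finite support, and there are only
  countably many such permutations to test. Otherwise, beyond every finite set some transposition
  of two elements fails to be an automorphism, so a copy \<open>K\<close> of \<open>M\<close> along a bijection \<open>p\<close> can be
  built in finite stages, where applying such a transposition or not stores one bit in the diagram
  of \<open>K\<close> (as in Knight's theorem on degree spectra). The bits stored are those of the graphs of
  \<open>p\<close> and \<open>f \<circ> p\<close>. Joining \<open>K\<close> to all structures onto which it codes an isomorphism is a Borel
  condition, and it makes \<open>K\<close> a common neighbour of \<open>M\<close> and \<open>N\<close>.
\<close>

section \<open>Diagrams\<close>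

type_synonym diagram = "nat \<Rightarrow> nat list \<Rightarrow> bool"

definition pull :: "diagram \<Rightarrow> (nat \<Rightarrow> nat) \<Rightarrow> diagram" where
  "pull A p = (\<lambda>i xs. A i (map p xs))"

lemma pull_pull: "pull (pull A p) q = pull A (p \<circ> q)"
  by (simp add: pull_def)

text \<open>Numbering the symbols and replacing functions by their graphs reduces a structure to
  countably many truth values, with relations at even and functions at odd indices.\<close>

definition diag :: "('r, 'f) language \<Rightarrow> ('r, 'f) nat_structure \<Rightarrow> diagram" where
  "diag L M i xs \<longleftrightarrow>
     (\<exists>R\<in>Rels L. i = 2 * to_nat_on (Rels L) R \<and> length xs = rel_arity L R \<and> fst M R xs) \<or>
     (\<exists>F\<in>Funs L. i = Suc (2 * to_nat_on (Funs L) F) \<and>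
        length xs = Suc (fun_arity L F) \<and> snd M F (butlast xs) = last xs)"

lemma diag_rel:
  assumes "countable_language L" "R \<in> Rels L"
  shows "diag L M (2 * to_nat_on (Rels L) R) xs \<longleftrightarrow> length xs = rel_arity L R \<and> fst M R xs"
proof -
  have "2 * a \<noteq> Suc (2 * b)" for a b :: nat by presburger
  then show ?thesis
    using assms by (auto simp: diag_def countable_language_def)
qed

lemma diag_fun:
  assumes "countable_language L" "F \<in> Funs L"
  shows "diag L M (Suc (2 * to_nat_on (Funs L) F)) xs \<longleftrightarrow>
     length xs = Suc (fun_arity L F) \<and> snd M F (butlast xs) = last xs"
proof -
  have "Suc (2 * a) \<noteq> 2 * b" for a b :: nat by presburger
  then show ?thesis
    using assms by (auto simp: diag_def countable_language_def)
qed

lemma is_isomorphism_iff_diag: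
  assumes L: "countable_language L" and "bij \<pi>"
  shows "is_isomorphism L \<pi> M N \<longleftrightarrow> diag L M = pull (diag L N) \<pi>"
proof
  assume iso: "is_isomorphism L \<pi> M N"
  have 1: "fst M R xs \<longleftrightarrow> fst N R (map \<pi> xs)"
    if "R \<in> Rels L" "length xs = rel_arity L R" for R xs
    using iso that by (simp add: is_isomorphism_def tuples_def)
  have 2: "snd M F (butlast xs) = last xs \<longleftrightarrow> snd N F (butlast (map \<pi> xs)) = last (map \<pi> xs)"
    if "F \<in> Funs L" "length xs = Suc (fun_arity L F)" for F xs
  proof -
    have "\<pi> (snd M F (butlast xs)) = snd N F (map \<pi> (butlast xs))"
      using iso that by (simp add: is_isomorphism_def tuples_def)
    moreover have "xs \<noteq> []" using that by auto
    ultimately show ?thesis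
      using \<open>bij \<pi>\<close> by (simp add: map_butlast last_map) (metis bij_pointE)
  qed
  show "diag L M = pull (diag L N) \<pi>"
    by (intro ext) (use 1 2 in \<open>auto simp: diag_def pull_def\<close>)
next
  assume eq: "diag L M = pull (diag L N) \<pi>"
  have "fst M R xs \<longleftrightarrow> fst N R (map \<pi> xs)"
    if "R \<in> Rels L" "length xs = rel_arity L R" for R xs
    using fun_cong[OF fun_cong[OF eq], of "2 * to_nat_on (Rels L) R" xs] that L
    by (simp add: pull_def diag_rel)
  moreover have "\<pi> (snd M F xs) = snd N F (map \<pi> xs)"
    if "F \<in> Funs L" "length xs = fun_arity L F" for F xs
    \<comment> \<open>At \<open>xs\<close> followed by its value, the graph of \<open>F\<close>
      holds in \<open>M\<close>.\<close>
    using fun_cong[OF fun_cong[OF eq], of "Suc (2 * to_nat_on (Funs L) F)" "xs @ [snd M F xs]"] that L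
    by (simp add: pull_def diag_fun)
  ultimately show "is_isomorphism L \<pi> M N"
    using \<open>bij \<pi>\<close> by (simp add: is_isomorphism_def tuples_def)
qed

lemma diag_inject:
  assumes L: "countable_language L" and M: "M \<in> Mod L" and N: "N \<in> Mod L"
    and eq: "diag L M = diag L N"
  shows "M = N"
proof -
  have iso: "is_isomorphism L id M N"
    using L eq by (simp add: is_isomorphism_iff_diag pull_def)
  have "fst M R xs = fst N R xs" for R xs
    using M N iso
    by (cases "R \<in> Rels L"; cases "xs \<in> tuples (rel_arity L R)")
       (auto simp: Mod_def is_isomorphism_def mem_Times_iff PiE_iff extensional_def)
  moreover have "snd M F xs = snd N F xs" for F xs
    using M N iso
    by (cases "F \<in> Funs L"; cases "xs \<in> tuples (fun_arity L F)")
       (auto simp: Mod_def is_isomorphism_def mem_Times_iff PiE_iff extensional_def)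
  ultimately show ?thesis by (intro prod_eqI ext) auto
qed

lemma is_isomorphism_unique:
  assumes "countable_language L" "N \<in> Mod L" "N' \<in> Mod L"
    and "is_isomorphism L \<pi> M N" "is_isomorphism L \<pi> M N'"
  shows "N = N'"
proof (rule diag_inject)
  have b: "bij \<pi>" using assms by (simp add: is_isomorphism_def)
  have "pull (diag L N) \<pi> = pull (diag L N') \<pi>"
    using assms b by (metis is_isomorphism_iff_diag)
  then have "pull (pull (diag L N) \<pi>) (inv \<pi>) = pull (pull (diag L N') \<pi>) (inv \<pi>)"
    by simp
  then show "diag L N = diag L N'"
    using b by (simp add: pull_pull surj_iff[THEN iffD1] bij_is_surj) (simp add: pull_def)
qed (use assms in auto)

lemma ex_Mod_pull:
  assumes L: "countable_language L" and b: "bij p"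
  shows "\<exists>K\<in>Mod L. is_isomorphism L p K M"
proof -
  define K where "K =
    (\<lambda>R\<in>Rels L. \<lambda>xs\<in>tuples (rel_arity L R). fst M R (map p xs),
     \<lambda>F\<in>Funs L. \<lambda>xs\<in>tuples (fun_arity L F). inv p (snd M F (map p xs)))"
  have "K \<in> Mod L"
    by (auto simp: K_def Mod_def)
  moreover have "is_isomorphism L p K M"
    using b by (auto simp: is_isomorphism_def K_def bij_is_surj surj_f_inv_f)
  ultimately show ?thesis by blast
qed


section \<open>Isomorphism by finite products of transpositions\<close>

abbreviation exchange :: "nat \<Rightarrow> nat \<Rightarrow> nat \<Rightarrow> nat" where
  "exchange \<equiv> Transposition.transpose"

text \<open>Indexing by lists, a countable type, keeps conditions quantifying over these
  permutations Borel.\<close>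

definition tperm :: "(nat \<times> nat) list \<Rightarrow> nat \<Rightarrow> nat" where
  "tperm l = foldr (\<lambda>(a, b) f. exchange a b \<circ> f) l id"

lemma tperm_simps [simp]:
  "tperm [] = id" "tperm ((a, b) # l) = exchange a b \<circ> tperm l"
  by (simp_all add: tperm_def)

lemma bij_tperm: "bij (tperm l)"
  by (induction l) (auto intro!: bij_comp bij_id bij_transpose simp del: id_apply)

lemma tperm_fixes:
  assumes "\<forall>(a, b)\<in>set l. n \<le> a \<and> n \<le> b" "x < n"
  shows "tperm l x = x"
  using assms by (induction l) (auto simp: Transposition.transpose_def)

text \<open>Points are added one at a time. If the two maps disagree at \<open>N\<close>, exchanging
  their values there corrects this; both values are at least \<open>n\<close> and differ from all
  earlier values.\<close>

lemma tperm_agrees: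
  assumes f: "bij f" and fx: "\<forall>x<n. f x = x"
  shows "\<exists>l. (\<forall>(a, b)\<in>set l. n \<le> a \<and> n \<le> b) \<and> (\<forall>x<N. tperm l x = f x)"
proof (induction N)
  case 0
  show ?case by (rule exI[of _ "[]"]) simp
next
  case (Suc N)
  then obtain l where l: "\<forall>(a, b)\<in>set l. n \<le> a \<and> n \<le> b" "\<forall>x<N. tperm l x = f x"
    by blast
  show ?case
  proof (cases "tperm l N = f N")
    case True
    then show ?thesis using l by (intro exI[of _ l]) (auto simp: less_Suc_eq)
  next
    case False
    have N: "n \<le> N"
      using False tperm_fixes[OF l(1)] fx by (metis not_less)
    have 1: "n \<le> f N"
      using N fx f by (metis bij_pointE not_less)
    have 2: "n \<le> tperm l N"
      using N tperm_fixes[OF l(1)] bij_tperm[of l] by (metis bij_pointE not_less)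
    have "f x \<noteq> f N" "tperm l x \<noteq> tperm l N" if "x < N" for x
      using that f bij_tperm[of l] by (metis bij_pointE less_irrefl)+
    then have "\<forall>x<Suc N. tperm ((tperm l N, f N) # l) x = f x"
      using l(2) by (auto simp: less_Suc_eq Transposition.transpose_def)
    then show ?thesis using l(1) 1 2 by (intro exI[of _ "(tperm l N, f N) # l"]) auto
  qed
qed

text \<open>
  A structure satisfying the negation of this predicate is fixed by all permutations that fix a
  suitable finite set pointwise.
\<close>

definition nontriv :: "diagram \<Rightarrow> bool" where
  "nontriv A \<longleftrightarrow> (\<forall>n. \<exists>j k i xs. n \<le> j \<and> n \<le> k \<and> A i (map (exchange j k) xs) \<noteq> A i xs)"

lemma pull_tperm_trivial:
  assumes "\<And>j k i xs. n \<le> j \<Longrightarrow> n \<le> k \<Longrightarrow> A i (map (exchange j k) xs) = A i xs"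
    and "\<forall>(a, b)\<in>set l. n \<le> a \<and> n \<le> b"
  shows "A i (map (tperm l) xs) = A i xs"
  using assms(2)
proof (induction l)
  case (Cons ab l)
  obtain a b where [simp]: "ab = (a, b)" by force
  show ?case
    using Cons assms(1)[of a b i "map (tperm l) xs"] by (simp add: comp_def)
qed simp

text \<open>If \<open>tperm l\<close> agrees with \<open>p\<close> below \<open>n\<close>, then
  \<open>r = inv p \<circ> tperm l\<close> fixes these points, and it remains to see that
  \<open>r\<close> preserves \<open>A\<close>.\<close>

lemma trivial_isomorphism_tperm:
  assumes "\<not> nontriv A" and p: "bij p" and A: "A = pull B p"
  shows "\<exists>l. A = pull B (tperm l)"
proof -
  obtain n where n: "\<And>j k i xs. n \<le> j \<Longrightarrow> n \<le> k \<Longrightarrow> A i (map (exchange j k) xs) = A i xs"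
    using assms(1) unfolding nontriv_def by blast
  obtain l where l: "\<forall>x<n. tperm l x = p x"
    using tperm_agrees[OF p, of 0 n] by auto
  define r where "r = inv p \<circ> tperm l"
  have r: "bij r"
    unfolding r_def by (intro bij_comp bij_tperm bij_imp_bij_inv p)
  have fx: "\<forall>x<n. r x = x"
    using l p by (simp add: r_def inv_f_f bij_is_inj)
  have "A i (map r xs) = A i xs" for i xs
  proof -
    \<comment> \<open>\<open>r\<close> may have infinite support, but on the finitely many points of
      one tuple it coincides with a product of exchanges beyond \<open>n\<close>.\<close>
    obtain N where N: "\<forall>x\<in>set xs. x < N"
      by (meson List.finite_set finite_nat_set_iff_bounded)
    obtain l' where l': "\<forall>(a, b)\<in>set l'. n \<le> a \<and> n \<le> b" "\<forall>x<N. tperm l' x = r x"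
      using tperm_agrees[OF r fx] by blast
    have "map r xs = map (tperm l') xs"
      using l'(2) N by auto
    then show ?thesis using pull_tperm_trivial[of n A l', OF n l'(1)] by metis
  qed
  then have "A = pull A r" by (auto simp: pull_def)
  also have "\<dots> = pull B (p \<circ> r)" by (subst A) (simp add: pull_pull)
  also have "p \<circ> r = tperm l"
    using p by (auto simp: r_def bij_is_surj surj_f_inv_f)
  finally show ?thesis by blast
qed

text \<open>Conjugation by \<open>p\<close> turns exchanges into exchanges. Starting beyond the
  images of the points below \<open>n\<close> keeps the preimages of \<open>j\<close> and
  \<open>k\<close> at or above \<open>n\<close>.\<close>

lemma nontriv_pull:
  assumes "nontriv A" and p: "bij p"
  shows "nontriv (pull A p)"
  unfolding nontriv_def
proof
  fix n
  obtain N where N: "\<forall>x\<in>p ` {..<n}. x < N"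
    by (meson finite_imageI finite_lessThan finite_nat_set_iff_bounded)
  obtain j k i xs where *: "N \<le> j" "N \<le> k" "A i (map (exchange j k) xs) \<noteq> A i xs"
    using assms(1) unfolding nontriv_def by blast
  define j' k' ys where "j' = inv p j" and "k' = inv p k" and "ys = map (inv p) xs"
  have pi: "p (inv p x) = x" for x
    using p by (simp add: bij_is_surj surj_f_inv_f)
  have "n \<le> j'" "n \<le> k'"
    using N *(1,2) pi unfolding j'_def k'_def
    by (metis imageI lessThan_iff not_less)+
  moreover have "p (exchange j' k' (inv p x)) = exchange j k x" for x
    using pi p by (auto simp: j'_def k'_def Transposition.transpose_def bij_inv_eq_iff)
  then have "map p (map (exchange j' k') ys) = map (exchange j k) xs" "map p ys = xs"
    using pi by (auto simp: ys_def map_idI)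
  ultimately show "\<exists>j k i xs. n \<le> j \<and> n \<le> k \<and>
      pull A p i (map (exchange j k) xs) \<noteq> pull A p i xs"
    using *(3) unfolding pull_def by metis
qed


section \<open>Coding information into a copy\<close>

text \<open>
  A mark beyond \<open>n\<close> is (the code of) a transposition of points \<open>\<ge> n\<close> with an atomic formula whose
  truth value it changes. The stored bit is the truth value of that formula at the least mark, and
  \<open>code_pos\<close> leaves one extra place after each mark so that \<open>p\<close> can be made surjective. It starts
  at 1 so that \<open>p x\<close> is determined before a bit with index \<open>k \<ge> x\<close> is stored.
\<close>

definition differs :: "diagram \<Rightarrow> nat \<Rightarrow> nat \<Rightarrow> bool" where
  "differs A n c \<longleftrightarrow> (case from_nat c of (j :: nat, k :: nat, i, xs) \<Rightarrow>
     n \<le> j \<and> n \<le> k \<and> A i (map (exchange j k) xs) \<noteq> A i xs)"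

definition mark :: "diagram \<Rightarrow> nat \<Rightarrow> nat" where
  "mark A n = (LEAST c. differs A n c)"

text \<open>The values of a bijection below this bound decide the formula both before and after the
  exchange.\<close>

definition mark_end :: "nat \<Rightarrow> nat" where
  "mark_end c = (case from_nat c of (j :: nat, k :: nat, i :: nat, xs) \<Rightarrow>
     Suc (Max (set (j # k # xs))))"

definition mark_value :: "diagram \<Rightarrow> nat \<Rightarrow> bool" where
  "mark_value A c = (case from_nat c of (j :: nat, k :: nat, i, xs) \<Rightarrow> A i xs)"

primrec code_pos :: "diagram \<Rightarrow> nat \<Rightarrow> nat" where
  "code_pos A 0 = 1"
| "code_pos A (Suc k) = Suc (mark_end (mark A (code_pos A k)))"

definition code_bit :: "diagram \<Rightarrow> nat \<Rightarrow> bool" where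
  "code_bit A k = mark_value A (mark A (code_pos A k))"

text \<open>One stage. The clause on all \<open>q'\<close> ensures that later stages disturb neither
  the stored bit nor the next position; hitting \<open>m\<close> serves surjectivity of the
  limit.\<close>

lemma coding_step:
  assumes A: "nontriv A" and p: "bij p"
  shows "\<exists>q n'. bij q \<and> (\<forall>x<n. q x = p x) \<and> n < n' \<and> m \<in> q ` {..<n'} \<and>
    (\<forall>q'. bij q' \<and> (\<forall>x<n'. q' x = q x) \<longrightarrow>
      Suc (mark_end (mark (pull A q') n)) = n' \<and>
      mark_value (pull A q') (mark (pull A q') n) = b)"
proof -
  \<comment> \<open>Minimizing the mark over all bijections extending the committed part ensures that no later
    choice can create a smaller mark.\<close>
  define P where "P c \<longleftrightarrow> (\<exists>q. bij q \<and> (\<forall>x<n. q x = p x) \<and> differs (pull A q) n c)" for c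
  obtain j0 k0 i0 xs0 where "n \<le> j0" "n \<le> k0"
    "pull A p i0 (map (exchange j0 k0) xs0) \<noteq> pull A p i0 xs0"
    using nontriv_pull[OF A p] unfolding nontriv_def by blast
  then have "P (to_nat (j0, k0, i0, xs0))"
    using p by (auto simp: P_def differs_def)
  then have "P (LEAST c. P c)" by (rule LeastI)
  then obtain c q where c: "c = (LEAST c. P c)"
    and q: "bij q" "\<forall>x<n. q x = p x" "differs (pull A q) n c"
    unfolding P_def by blast
  have min: "\<not> P c'" if "c' < c" for c'
    using that unfolding c by (rule not_less_Least)
  obtain j k i xs where d: "from_nat c = (j :: nat, k :: nat, i :: nat, xs :: nat list)"
    by (metis prod.exhaust)
  have jk: "n \<le> j" "n \<le> k" "pull A q i (map (exchange j k) xs) \<noteq> pull A q i xs"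
    using q(3) by (auto simp: differs_def d)
  \<comment> \<open>The exchange flips the formula and moves only points at or above
    \<open>n\<close>, so one of the two choices stores \<open>b\<close>.\<close>
  define q1 where "q1 = (if pull A q i xs = b then q else q \<circ> exchange j k)"
  have q1: "bij q1" "\<forall>x<n. q1 x = p x"
    using q(1,2) jk by (auto simp: q1_def Transposition.transpose_def intro!: bij_comp)
  have q1b: "pull A q1 i xs = b" "pull A q1 i (map (exchange j k) xs) \<noteq> b"
    using jk(3) by (auto simp: q1_def pull_def comp_assoc)
  define e where "e = mark_end c"
  have e: "j < e" "k < e" "\<forall>x\<in>set xs. x < e"
    by (auto simp: e_def mark_end_def d less_Suc_eq_le simp del: Max_insert intro!: Max_ge)
  obtain y where y: "q1 y = m" using q1(1) by (metis bij_pointE)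
  \<comment> \<open>The spare place \<open>e\<close> receives \<open>m\<close> if \<open>m\<close>
    is not yet a value below \<open>e\<close>; places below \<open>e\<close> keep their
    values.\<close>
  define q2 where "q2 = (if y < e then q1 else q1 \<circ> exchange e y)"
  have q2: "bij q2" "\<forall>x<e. q2 x = q1 x"
    using q1(1) by (auto simp: q2_def Transposition.transpose_def intro!: bij_comp)
  have m: "m \<in> q2 ` {..<Suc e}"
  proof (cases "y < e")
    case True
    then show ?thesis using y by (auto simp: q2_def intro!: image_eqI[of _ _ y])
  next
    case False
    then show ?thesis using y by (auto simp: q2_def intro!: image_eqI[of _ _ e])
  qed
  have "mark (pull A q') n = c \<and> mark_value (pull A q') c = b"
    if q': "bij q'" "\<forall>x<Suc e. q' x = q2 x" for q'
  proof -
    have agree: "\<forall>x<e. q' x = q1 x" using q' q2 by auto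
    then have "map q' xs = map q1 xs"
      "map q' (map (exchange j k) xs) = map q1 (map (exchange j k) xs)"
      using e by (auto simp: Transposition.transpose_def)
    then have v: "pull A q' i xs = b" "pull A q' i (map (exchange j k) xs) \<noteq> b"
      using q1b unfolding pull_def by metis+
    then have D: "differs (pull A q') n c"
      using jk by (auto simp: differs_def d)
    \<comment> \<open>A smaller mark for \<open>q'\<close> would satisfy \<open>P\<close> with
      \<open>q'\<close> as witness, against minimality.\<close>
    have "\<forall>x<n. q' x = p x"
      using agree q1(2) e(1) jk(1) by auto
    then have "\<not> differs (pull A q') n c'" if "c' < c" for c'
      using min[OF that] q'(1) unfolding P_def by blast
    then have "mark (pull A q') n = c"
      unfolding mark_def using D by (intro Least_equality) (auto simp: not_less[symmetric])
    then show ?thesis using v by (simp add: mark_value_def d)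
  qed
  moreover have "\<forall>x<n. q2 x = p x" "n < Suc e"
    using q2(2) q1(2) e(1) jk(1) by auto
  ultimately show ?thesis
    using q2(1) m by (intro exI[of _ q2] exI[of _ "Suc e"]) (auto simp: e_def)
qed

text \<open>Bit \<open>k\<close> may depend on the values of \<open>p\<close> fixed before it is
  stored, so the copy can describe \<open>p\<close> itself. The bijection is the limit of stages
  given by \<open>coding_step\<close>.\<close>

lemma coding:
  assumes A: "nontriv A"
  shows "\<exists>p. bij p \<and> (\<forall>k. k < code_pos (pull A p) k \<and>
    code_bit (pull A p) k = b k (map p [0..<code_pos (pull A p) k]))"
proof -
  \<comment> \<open>A state is a bijection with the length of its committed initial segment.\<close>
  define Q where "Q k s t \<longleftrightarrow> (case s of (p, n) \<Rightarrow> case t of (q, n') \<Rightarrow>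
     (\<forall>x<n. q x = p x) \<and> n < n' \<and> k \<in> q ` {..<n'} \<and>
    (\<forall>q'. bij q' \<and> (\<forall>x<n'. q' x = q x) \<longrightarrow>
      Suc (mark_end (mark (pull A q') n)) = n' \<and>
      mark_value (pull A q') (mark (pull A q') n) = b k (map p [0..<n])))"
    for k :: nat and s t :: "(nat \<Rightarrow> nat) \<times> nat"
  define P where "P k s \<longleftrightarrow> bij (fst s) \<and> (k = 0 \<longrightarrow> snd s = 1)"
    for k :: nat and s :: "(nat \<Rightarrow> nat) \<times> nat"
  have "\<exists>s. P 0 s" by (rule exI[of _ "(id, 1)"]) (simp add: P_def)
  moreover have "\<exists>t. P (Suc k) t \<and> Q k s t" if s: "P k s" for k s
  proof -
    obtain p n where [simp]: "s = (p, n)" by force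
    have "bij p" using s by (simp add: P_def)
    from coding_step[OF A this, of n k "b k (map p [0..<n])"]
    obtain q n' where "bij q" "Q k s (q, n')" unfolding Q_def by auto
    then show ?thesis by (intro exI[of _ "(q, n')"]) (simp add: P_def)
  qed
  ultimately obtain s where s: "\<And>k. P k (s k)" "\<And>k. Q k (s k) (s (Suc k))"
    using dependent_nat_choice[of P Q] by blast
  define p n where "p k = fst (s k)" and "n k = snd (s k)" for k
  have n0: "n 0 = 1" and bij: "bij (p k)" for k
    using s(1)[of 0] s(1)[of k] by (auto simp: P_def p_def n_def)
  have step: "\<forall>x<n k. p (Suc k) x = p k x" "n k < n (Suc k)" "k \<in> p (Suc k) ` {..<n (Suc k)}"
    "\<And>q'. bij q' \<Longrightarrow> \<forall>x<n (Suc k). q' x = p (Suc k) x \<Longrightarrow>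
      Suc (mark_end (mark (pull A q') (n k))) = n (Suc k) \<and>
      mark_value (pull A q') (mark (pull A q') (n k)) = b k (map (p k) [0..<n k])" for k
    using s(2)[of k] unfolding Q_def p_def n_def by (auto split: prod.splits)
  have nk: "k < n k" for k
  proof (induction k)
    case (Suc k)
    then show ?case using step(2)[of k] by simp
  qed (simp add: n0)
  have nmono: "n k \<le> n k'" if "k \<le> k'" for k k'
    using lift_Suc_mono_le[of n, OF less_imp_le[OF step(2)] that] .
  have agree: "p (k + d) x = p k x" if "x < n k" for k d x
  proof (induction d)
    case (Suc d)
    have "x < n (k + d)" using that nmono[of k "k + d"] by simp
    then show ?case using Suc step(1)[of "k + d"] by simp
  qed simp
  \<comment> \<open>Since \<open>x < n x\<close>, the value \<open>p x x\<close> is already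
    final.\<close>
  define q where "q x = p x x" for x
  have q: "q x = p k x" if "x < n k" for x k
  proof (cases "k \<le> x")
    case True
    then show ?thesis using agree[OF that, of "x - k"] by (simp add: q_def)
  next
    case False
    then show ?thesis using agree[OF nk[of x], of "k - x"] by (simp add: q_def)
  qed
  have "bij q"
  proof (rule bijI)
    show "inj q"
    proof (rule injI)
      fix x y assume xy: "q x = q y"
      have "x < n (max x y)" "y < n (max x y)"
        using nk[of "max x y"] by auto
      then show "x = y" using xy q bij[of "max x y"] by (metis bij_pointE)
    qed
    have "y \<in> range q" for y
      using step(3)[of y] q[of _ "Suc y"] by force
    then show "surj q" by blast
  qed
  have st: "Suc (mark_end (mark (pull A q) (n k))) = n (Suc k)"
    "mark_value (pull A q) (mark (pull A q) (n k)) = b k (map (p k) [0..<n k])" for k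
    using step(4)[OF \<open>bij q\<close>, of k] q by auto
  \<comment> \<open>The positions computed from the limit are those of the construction; both start
    at 1.\<close>
  have pos: "code_pos (pull A q) k = n k" for k
    by (induction k) (use n0 st(1) in auto)
  have "map (p k) [0..<n k] = map q [0..<n k]" for k
    using q by auto
  then have "code_bit (pull A q) k = b k (map q [0..<n k])" for k
    unfolding code_bit_def pos st(2) by (rule arg_cong)
  then show ?thesis
    using \<open>bij q\<close> nk by (intro exI[of _ q]) (simp add: pos)
qed

section \<open>Isomorphisms stored in a diagram\<close>

definition decode :: "diagram \<Rightarrow> nat \<Rightarrow> nat \<Rightarrow> nat \<Rightarrow> bool" where
  "decode A c x y = code_bit A (prod_encode (c, prod_encode (x, y)))"

text \<open>The entry \<open>l ! x\<close> in \<open>b\<close> is \<open>p x\<close>: the index of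
  the bit is at least \<open>x\<close>, so this value is committed before the bit is stored. The
  number \<open>c\<close> lets one copy store many functions.\<close>

lemma coding_functions:
  fixes F :: "nat \<Rightarrow> nat \<Rightarrow> nat"
  assumes "nontriv A"
  shows "\<exists>p. bij p \<and> (\<forall>c x y. decode (pull A p) c x y \<longleftrightarrow> y = F c (p x))"
proof -
  define b where "b k l = (case prod_decode k of (c, xy) \<Rightarrow> case prod_decode xy of (x, y) \<Rightarrow>
    y = F c (l ! x))" for k l
  obtain p where p: "bij p" "\<And>k. k < code_pos (pull A p) k"
    "\<And>k. code_bit (pull A p) k = b k (map p [0..<code_pos (pull A p) k])"
    using coding[OF assms, of b] by blast
  have "decode (pull A p) c x y \<longleftrightarrow> y = F c (p x)" for c x y
  proof -
    define k where "k = prod_encode (c, prod_encode (x, y))"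
    have "x \<le> k"
      using le_prod_encode_1[of x y] le_prod_encode_2[of "prod_encode (x, y)" c]
      by (simp add: k_def)
    then have "x < code_pos (pull A p) k" using p(2)[of k] by simp
    then show ?thesis
      using p(3)[of k] by (simp add: decode_def k_def b_def)
  qed
  then show ?thesis using p(1) by blast
qed

definition finitary_iso :: "diagram \<Rightarrow> diagram \<Rightarrow> bool" where
  "finitary_iso A B \<longleftrightarrow> (\<exists>l. \<forall>i xs. A i xs = B i (map (tperm l) xs))"

text \<open>All quantifiers range over countable sets, which keeps the condition Borel;
  \<open>list_all2\<close> transports tuples without quantifying over bijections.\<close>

definition coded_iso :: "diagram \<Rightarrow> diagram \<Rightarrow> bool" where
  "coded_iso A B \<longleftrightarrow> (\<exists>c.
     (\<forall>x. \<exists>y. decode A c x y) \<and> (\<forall>y. \<exists>x. decode A c x y) \<and>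
     (\<forall>x y z. decode A c x y \<longrightarrow> decode A c x z \<longrightarrow> y = z) \<and>
     (\<forall>x y z. decode A c x z \<longrightarrow> decode A c y z \<longrightarrow> x = y) \<and>
     (\<forall>i xs ys. list_all2 (decode A c) xs ys \<longrightarrow> A i xs = B i ys))"

lemma finitary_iso_sound:
  assumes "finitary_iso A B"
  shows "\<exists>p. bij p \<and> A = pull B p"
  using assms bij_tperm unfolding finitary_iso_def pull_def by blast

text \<open>\<open>A\<close> is arbitrary and may have no marks at all: since the decoded relation
  is verified, accidental bits never give a false edge.\<close>

lemma coded_iso_sound:
  assumes "coded_iso A B"
  shows "\<exists>p. bij p \<and> A = pull B p"
proof -
  obtain c where c: "\<forall>x. \<exists>y. decode A c x y" "\<forall>y. \<exists>x. decode A c x y"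
     "\<forall>x y z. decode A c x y \<longrightarrow> decode A c x z \<longrightarrow> y = z"
     "\<forall>x y z. decode A c x z \<longrightarrow> decode A c y z \<longrightarrow> x = y"
     "\<forall>i xs ys. list_all2 (decode A c) xs ys \<longrightarrow> A i xs = B i ys"
    using assms unfolding coded_iso_def by (elim exE conjE) (rule that)
  obtain p where p: "\<And>x. decode A c x (p x)" using c(1) by metis
  have "inj p" using p c(4) by (metis injI)
  moreover have "surj p" using p c(2,3) by (metis surj_def)
  ultimately have "bij p" by (simp add: bij_def)
  moreover have "list_all2 (decode A c) xs (map p xs)" for xs
    using p by (simp add: list_all2_conv_all_nth)
  then have "A = pull B p" using c(5) unfolding pull_def by (intro ext) blast
  ultimately show ?thesis by blast
qed

lemma coded_isoI:
  assumes p: "bij p" "A = pull B p" and dec: "\<And>x y. decode A c x y \<longleftrightarrow> y = p x"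
  shows "coded_iso A B"
proof -
  have "A i xs = B i ys" if "list_all2 (decode A c) xs ys" for i xs ys
  proof -
    have "ys = map p xs"
      using that dec by (auto simp: list_all2_conv_all_nth intro: nth_equalityI)
    then show ?thesis using p(2) by (simp add: pull_def)
  qed
  moreover have "\<forall>y. \<exists>x. y = p x" "\<forall>x y. p x = p y \<longrightarrow> x = y"
    using p(1) by (metis bij_pointE)+
  ultimately show ?thesis
    unfolding coded_iso_def by (intro exI[of _ c]) (metis dec)
qed

lemma coded_iso_common:
  assumes A: "nontriv A" and f: "bij f" "A = pull B f"
  shows "\<exists>p. bij p \<and> coded_iso (pull A p) A \<and> coded_iso (pull A p) B"
proof -
  \<comment> \<open>Index 0 stores \<open>p\<close>, the isomorphism onto \<open>A\<close>, and
    index 1 stores \<open>f \<circ> p\<close>, the one onto \<open>B\<close>.\<close>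
  define F where "F c = (if c = 0 then id else f)" for c :: nat
  obtain p where p: "bij p" and dec: "\<And>c x y. decode (pull A p) c x y \<longleftrightarrow> y = F c (p x)"
    using coding_functions[OF A, of F] by blast
  have "coded_iso (pull A p) A"
    by (rule coded_isoI[of p _ _ 0]) (use p dec in \<open>auto simp: F_def\<close>)
  moreover have "coded_iso (pull A p) B"
    by (rule coded_isoI[of "f \<circ> p" _ _ 1])
       (use p f dec in \<open>auto simp: F_def pull_pull intro: bij_comp\<close>)
  ultimately show ?thesis using p by blast
qed


section \<open>Borel measurability\<close>

lemma measurable_mark:
  assumes [measurable]: "\<And>i xs. Measurable.pred S (\<lambda>z. A z i xs)"
  shows "(\<lambda>z. mark (A z) n) \<in> measurable S (count_space UNIV)"
proof -
  have [measurable]: "Measurable.pred S (\<lambda>z. differs (A z) n c)" for n c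
    by (cases "from_nat c :: nat \<times> nat \<times> nat \<times> nat list") (simp add: differs_def)
  show ?thesis
    unfolding mark_def by measurable
qed

lemma measurable_code_pos:
  assumes [measurable]: "\<And>i xs. Measurable.pred S (\<lambda>z. A z i xs)"
  shows "(\<lambda>z. code_pos (A z) k) \<in> measurable S (count_space UNIV)"
proof -
  note mark = measurable_mark[OF assms]
  show ?thesis
  proof (induction k)
    case (Suc k)
    \<comment> \<open>The position varies with \<open>z\<close> but has countably many values, and
      on each of them it is a constant.\<close>
    have "(\<lambda>z. mark (A z) (code_pos (A z) k)) \<in> measurable S (count_space UNIV)"
      by (rule measurable_compose_countable[OF mark Suc])
    then show ?case
      unfolding code_pos.simps by (rule measurable_compose) simp
  qed simp
qed

lemma pred_code_bit:
  assumes [measurable]: "\<And>i xs. Measurable.pred S (\<lambda>z. A z i xs)"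
  shows "Measurable.pred S (\<lambda>z. code_bit (A z) k)"
proof -
  have 1: "(\<lambda>z. mark (A z) (code_pos (A z) k)) \<in> measurable S (count_space UNIV)"
    by (rule measurable_compose_countable[OF measurable_mark measurable_code_pos]) fact+
  have 2: "Measurable.pred S (\<lambda>z. mark_value (A z) c)" for c
    by (cases "from_nat c :: nat \<times> nat \<times> nat \<times> nat list") (simp add: mark_value_def)
  show ?thesis
    unfolding code_bit_def by (rule measurable_compose_countable[OF 2 1])
qed

lemma pred_finitary_iso:
  assumes [measurable]: "\<And>i xs. Measurable.pred S (\<lambda>z. A z i xs)"
    "\<And>i xs. Measurable.pred S (\<lambda>z. B z i xs)"
  shows "Measurable.pred S (\<lambda>z. finitary_iso (A z) (B z))"
  unfolding finitary_iso_def by measurable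

lemma pred_coded_iso:
  assumes [measurable]: "\<And>i xs. Measurable.pred S (\<lambda>z. A z i xs)"
    "\<And>i xs. Measurable.pred S (\<lambda>z. B z i xs)"
  shows "Measurable.pred S (\<lambda>z. coded_iso (A z) (B z))"
proof -
  have [measurable]: "Measurable.pred S (\<lambda>z. decode (A z) c x y)" for c x y
    unfolding decode_def by (rule pred_code_bit) fact
  have [measurable]: "Measurable.pred S (\<lambda>z. list_all2 (decode (A z) c) xs ys)" for c xs ys
    unfolding list_all2_conv_all_nth by measurable
  show ?thesis
    unfolding coded_iso_def by measurable
qed

section \<open>Borel sets of pairs of structures\<close>

definition Mod_pair_measure ::
  "('r, 'f) language \<Rightarrow> (('r, 'f) nat_structure \<times> ('r, 'f) nat_structure) measure" where
  "Mod_pair_measure L = sigma (Mod L \<times> Mod L)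
     {U. openin (prod_topology (Mod_topology L) (Mod_topology L)) U}"

lemma opens_subset:
  "{U. openin (prod_topology (Mod_topology L) (Mod_topology L)) U} \<subseteq> Pow (Mod L \<times> Mod L)"
  using openin_subset[of "prod_topology (Mod_topology L) (Mod_topology L)"] by auto

lemma space_Mod_pair_measure [simp]: "space (Mod_pair_measure L) = Mod L \<times> Mod L"
  by (simp add: Mod_pair_measure_def space_measure_of opens_subset)

lemma sets_Mod_pair_measure:
  "sets (Mod_pair_measure L) = borel_sets_of (prod_topology (Mod_topology L) (Mod_topology L))"
  by (simp add: Mod_pair_measure_def borel_sets_of_def sets_measure_of opens_subset)

lemma continuous_map_interpretation:
  shows "R \<in> Rels L \<Longrightarrow> xs \<in> tuples (rel_arity L R) \<Longrightarrow>
      continuous_map (Mod_topology L) (discrete_topology UNIV) (\<lambda>M. fst M R xs)"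
    and "F \<in> Funs L \<Longrightarrow> xs \<in> tuples (fun_arity L F) \<Longrightarrow>
      continuous_map (Mod_topology L) (discrete_topology UNIV) (\<lambda>M. snd M F xs)"
proof -
  let ?D = "\<lambda>xs. discrete_topology UNIV"
  assume R: "R \<in> Rels L" "xs \<in> tuples (rel_arity L R)"
  have "continuous_map (Mod_topology L)
      (product_topology (\<lambda>R. product_topology ?D (tuples (rel_arity L R))) (Rels L)) fst"
    unfolding Mod_topology_def by (rule continuous_map_fst)
  from continuous_map_compose[OF continuous_map_compose[OF this
      continuous_map_product_projection[OF R(1)]] continuous_map_product_projection[OF R(2)]]
  show "continuous_map (Mod_topology L) (discrete_topology UNIV) (\<lambda>M. fst M R xs)"
    by (simp add: comp_def)
next
  let ?D = "\<lambda>xs. discrete_topology UNIV"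
  assume F: "F \<in> Funs L" "xs \<in> tuples (fun_arity L F)"
  have "continuous_map (Mod_topology L)
      (product_topology (\<lambda>F. product_topology ?D (tuples (fun_arity L F))) (Funs L)) snd"
    unfolding Mod_topology_def by (rule continuous_map_snd)
  from continuous_map_compose[OF continuous_map_compose[OF this
      continuous_map_product_projection[OF F(1)]] continuous_map_product_projection[OF F(2)]]
  show "continuous_map (Mod_topology L) (discrete_topology UNIV) (\<lambda>M. snd M F xs)"
    by (simp add: comp_def)
qed

lemma measurable_continuous_discrete:
  assumes "continuous_map (prod_topology (Mod_topology L) (Mod_topology L))
    (discrete_topology UNIV) f"
  shows "f \<in> measurable (Mod_pair_measure L) (count_space UNIV)"
proof (rule measurableI)
  fix U
  have "openin (prod_topology (Mod_topology L) (Mod_topology L)) {z \<in> Mod L \<times> Mod L. f z \<in> U}"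
    using openin_continuous_map_preimage[OF assms, of U] by simp
  then show "f -` U \<inter> space (Mod_pair_measure L) \<in> sets (Mod_pair_measure L)"
    by (auto simp: sets_Mod_pair_measure borel_sets_of_def vimage_def Int_def conj_commute
        intro!: sigma_sets.Basic)
qed simp

text \<open>Each symbol contributes a constant condition or a preimage under a continuous map to a
  discrete space; the union over symbols is countable.\<close>

lemma pred_diag:
  assumes L: "countable_language L"
    and g: "g = fst \<or> g = snd"
  shows "Measurable.pred (Mod_pair_measure L) (\<lambda>z. diag L (g z) i xs)"
proof -
  have countable: "countable (Rels L)" "countable (Funs L)"
    using L by (auto simp: countable_language_def)
  have cg: "continuous_map (prod_topology (Mod_topology L) (Mod_topology L)) (Mod_topology L) g"
    using g by (auto intro: continuous_map_fst continuous_map_snd)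
  have R: "Measurable.pred (Mod_pair_measure L)
      (\<lambda>z. i = 2 * to_nat_on (Rels L) R \<and> length xs = rel_arity L R \<and> fst (g z) R xs)"
    if "R \<in> Rels L" for R
  proof (cases "length xs = rel_arity L R")
    case True
    have "(\<lambda>z. fst (g z) R xs) \<in> measurable (Mod_pair_measure L) (count_space UNIV)"
      by (rule measurable_continuous_discrete)
         (use continuous_map_compose[OF cg continuous_map_interpretation(1)[OF that]] True
          in \<open>simp add: comp_def tuples_def\<close>)
    then show ?thesis by simp
  qed simp
  have F: "Measurable.pred (Mod_pair_measure L)
      (\<lambda>z. i = Suc (2 * to_nat_on (Funs L) F) \<and> length xs = Suc (fun_arity L F) \<and>
        snd (g z) F (butlast xs) = last xs)"
    if "F \<in> Funs L" for F
  proof (cases "length xs = Suc (fun_arity L F)")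
    case True
    have "(\<lambda>z. snd (g z) F (butlast xs)) \<in> measurable (Mod_pair_measure L) (count_space UNIV)"
      by (rule measurable_continuous_discrete)
         (use continuous_map_compose[OF cg continuous_map_interpretation(2)[OF that]] True
          in \<open>simp add: comp_def tuples_def\<close>)
    then have "Measurable.pred (Mod_pair_measure L) (\<lambda>z. snd (g z) F (butlast xs) = last xs)"
      by measurable
    then show ?thesis by simp
  qed simp
  show ?thesis
    unfolding diag_def pred_def
    by (intro sets.sets_Collect_disj sets.sets_Collect_countable_Ex'
        R[unfolded pred_def] F[unfolded pred_def]) (assumption | simp only: countable)+
qed


section \<open>A countable isomorphism class\<close>

text \<open>All symbols single out one point. Copies are again of this form, so the isomorphism
  class is countable and a graph on it can be prescribed by hand.\<close>

definition point_structure :: "('r, 'f) language \<Rightarrow> nat \<Rightarrow> ('r, 'f) nat_structure" where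
  "point_structure L k =
     (\<lambda>R\<in>Rels L. \<lambda>xs\<in>tuples (rel_arity L R). set xs \<subseteq> {k},
      \<lambda>F\<in>Funs L. \<lambda>xs\<in>tuples (fun_arity L F). k)"

lemma point_structure_in_Mod: "point_structure L k \<in> Mod L"
  by (auto simp: point_structure_def Mod_def)

lemma is_isomorphism_point_structure:
  assumes "bij \<pi>"
  shows "is_isomorphism L \<pi> (point_structure L k) (point_structure L (\<pi> k))"
proof -
  have "\<pi> x = \<pi> k \<longleftrightarrow> x = k" for x
    using assms by (metis bij_pointE)
  then show ?thesis
    using assms by (auto simp: is_isomorphism_def point_structure_def tuples_def)
qed

text \<open>Ensures that the two clauses of \<open>iso_graph\<close> never meet within one
  isomorphism class.\<close>

lemma isomorphic_point_structure:
  assumes L: "countable_language L" and "(M, N) \<in> isomorphism_rel L"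
  shows "M \<in> range (point_structure L) \<longleftrightarrow> N \<in> range (point_structure L)"
proof -
  have *: "N \<in> range (point_structure L)"
    if MN: "(M, N) \<in> isomorphism_rel L" "M \<in> range (point_structure L)" for M N
  proof -
    obtain \<pi> k where \<pi>: "is_isomorphism L \<pi> M N" "N \<in> Mod L" "M = point_structure L k"
      using MN unfolding isomorphism_rel_def by blast
    then have "N = point_structure L (\<pi> k)"
      using is_isomorphism_point_structure[of \<pi> L k] L point_structure_in_Mod[of L "\<pi> k"]
      by (metis is_isomorphism_def is_isomorphism_unique)
    then show ?thesis by blast
  qed
  have "(N, M) \<in> isomorphism_rel L"
    using equiv_isomorphism_rel[of L] assms(2) by (meson equivE symD)
  then show ?thesis using * assms(2) by blast
qed

lemma point_structures_isomorphic:
  "(point_structure L j, point_structure L k) \<in> isomorphism_rel L"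
proof -
  have "is_isomorphism L (exchange j k) (point_structure L j) (point_structure L k)"
    using is_isomorphism_point_structure[OF bij_transpose[of j k], of L j] by simp
  then show ?thesis
    using point_structure_in_Mod unfolding isomorphism_rel_def by blast
qed

text \<open>The point is the value of any function symbol, and the only one whose constant tuple
  satisfies a relation of positive arity.\<close>

lemma inj_point_structure:
  assumes "\<not> propositional_language L"
  shows "inj (point_structure L)"
proof (rule injI)
  fix j k assume eq: "point_structure L j = point_structure L k"
  consider F where "F \<in> Funs L" | R where "R \<in> Rels L" "rel_arity L R \<noteq> 0"
    using assms unfolding propositional_language_def by blast
  then show "j = k"
  proof cases
    case 1
    then have "snd (point_structure L l) F (replicate (fun_arity L F) 0) = l" for l
      by (simp add: point_structure_def tuples_def)
    then show ?thesis using eq by metis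
  next
    case 2
    then have "fst (point_structure L l) R (replicate (rel_arity L R) j) \<longleftrightarrow> j = l" for l
      by (simp add: point_structure_def tuples_def)
    then show ?thesis using eq by metis
  qed
qed


section \<open>The graph\<close>

lemma connectedness_rel_eq:
  assumes E: "equiv V E" and G: "G \<subseteq> E"
    and two: "\<And>x y. (x, y) \<in> E \<Longrightarrow> x = y \<or> (x, y) \<in> G \<or> (\<exists>z. (x, z) \<in> G \<and> (z, y) \<in> G)"
  shows "connectedness_rel V G = E"
proof -
  have V: "E \<subseteq> V \<times> V" and refl: "\<And>x. x \<in> V \<Longrightarrow> (x, x) \<in> E" and tr: "trans E"
    using E by (auto simp: equiv_def refl_on_def)
  have "(x, y) \<in> E" if "(x, y) \<in> G\<^sup>*" "x \<in> V" for x y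
    using that
  proof (induction rule: rtrancl_induct)
    case base
    then show ?case by (rule refl)
  next
    case (step y z)
    then show ?case using G tr by (meson subsetD transD)
  qed
  moreover have "(x, y) \<in> G\<^sup>*" if "(x, y) \<in> E" for x y
    using two[OF that] by (auto intro: rtrancl_trans)
  ultimately show ?thesis
    using V unfolding connectedness_rel_def by blast
qed

lemma graph_diameter_le_2:
  assumes "connectedness_rel V G = E"
    and two: "\<And>x y. (x, y) \<in> E \<Longrightarrow> x = y \<or> (x, y) \<in> G \<or> (\<exists>z. (x, z) \<in> G \<and> (z, y) \<in> G)"
  shows "graph_diameter V G \<le> 2"
proof -
  have "graph_distance G x y \<le> 2" if "(x, y) \<in> E" for x y
  proof -
    have "\<exists>n\<le>2. (x, y) \<in> G ^^ n"
      using two[OF that]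
    proof (elim disjE exE)
      assume "x = y" then show ?thesis by (intro exI[of _ 0]) simp
    next
      assume "(x, y) \<in> G" then show ?thesis by (intro exI[of _ 1]) simp
    next
      fix z assume "(x, z) \<in> G \<and> (z, y) \<in> G"
      then show ?thesis by (intro exI[of _ 2]) (auto simp: numeral_2_eq_2)
    qed
    then show ?thesis
      unfolding graph_distance_def by (meson Least_le order_trans)
  qed
  then show ?thesis
    unfolding graph_diameter_def assms(1)
    by (auto intro!: SUP_least simp: numeral_eq_enat)
qed

lemma graph_diameter_ge_2:
  assumes "(x, y) \<in> connectedness_rel V G" "x \<noteq> y" "(x, y) \<notin> G"
  shows "2 \<le> graph_diameter V G"
proof -
  have "\<exists>n. (x, y) \<in> G ^^ n"
    using assms(1) by (auto simp: connectedness_rel_def dest: rtrancl_imp_relpow)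
  then have "(x, y) \<in> G ^^ graph_distance G x y"
    unfolding graph_distance_def by (rule LeastI_ex)
  then have "graph_distance G x y \<noteq> 0" "graph_distance G x y \<noteq> 1"
    using assms(2,3) by (auto intro!: gr0I)
  then have "2 \<le> graph_distance G x y" by linarith
  then have "2 \<le> enat (graph_distance G x y)" by (simp add: numeral_eq_enat)
  also have "\<dots> \<le> graph_diameter V G"
    unfolding graph_diameter_def using assms(1) by (intro SUP_upper2[of "(x, y)"]) auto
  finally show ?thesis .
qed

text \<open>This is directed: the code of an isomorphism onto \<open>N\<close> lies in
  \<open>M\<close>. It is symmetrized in \<open>iso_graph\<close>.\<close>

definition adjacent :: "('r, 'f) language \<Rightarrow> ('r, 'f) nat_structure \<Rightarrow> ('r, 'f) nat_structure \<Rightarrow> bool"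
where
  "adjacent L M N \<longleftrightarrow>
     finitary_iso (diag L M) (diag L N) \<or> coded_iso (diag L M) (diag L N)"

lemma adjacent_isomorphic:
  assumes "countable_language L" "M \<in> Mod L" "N \<in> Mod L" "adjacent L M N"
  shows "(M, N) \<in> isomorphism_rel L"
proof -
  obtain p where "bij p" "diag L M = pull (diag L N) p"
    using assms(4) finitary_iso_sound coded_iso_sound unfolding adjacent_def by metis
  then have "is_isomorphism L p M N"
    using is_isomorphism_iff_diag[OF assms(1)] by simp
  then show ?thesis using assms(2,3) unfolding isomorphism_rel_def by blast
qed

lemma isomorphic_adjacent:
  assumes L: "countable_language L" and MN: "(M, N) \<in> isomorphism_rel L"
  shows "adjacent L M N \<or> (\<exists>K\<in>Mod L. adjacent L K M \<and> adjacent L K N)"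
proof -
  obtain \<pi> where \<pi>: "bij \<pi>" "diag L M = pull (diag L N) \<pi>"
    using MN L unfolding isomorphism_rel_def
    by (auto simp: is_isomorphism_iff_diag) (metis is_isomorphism_def is_isomorphism_iff_diag)
  show ?thesis
  proof (cases "nontriv (diag L M)")
    case True
    obtain p where p: "bij p" "coded_iso (pull (diag L M) p) (diag L M)"
      "coded_iso (pull (diag L M) p) (diag L N)"
      using coded_iso_common[OF True \<pi>] by blast
    obtain K where "K \<in> Mod L" "is_isomorphism L p K M"
      using ex_Mod_pull[OF L p(1)] by blast
    then show ?thesis
      using p L unfolding adjacent_def by (metis is_isomorphism_iff_diag)
  next
    case False
    then have "finitary_iso (diag L M) (diag L N)"
      using trivial_isomorphism_tperm[OF False \<pi>] unfolding finitary_iso_def pull_def by metis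
    then show ?thesis by (simp add: adjacent_def)
  qed
qed

text \<open>
  If all structures of the language are adjacent to their copies, as for a language with a single
  constant, adjacency alone has diameter 1. Replacing it by a star on one countable isomorphism
  class makes the diameter exactly 2.
\<close>

definition iso_graph :: "('r, 'f) language \<Rightarrow> (('r, 'f) nat_structure \<times> ('r, 'f) nat_structure) set"
where
  "iso_graph L = {(M, N). M \<in> Mod L \<and> N \<in> Mod L \<and> M \<noteq> N \<and>
     (if M \<in> range (point_structure L) \<or> N \<in> range (point_structure L)
      then M \<in> range (point_structure L) \<and> N \<in> range (point_structure L) \<and>
        (M = point_structure L 0 \<or> N = point_structure L 0)
      else adjacent L M N \<or> adjacent L N M)}"

lemma sym_iso_graph: "sym (iso_graph L)"
proof (rule symI)
  fix M N assume "(M, N) \<in> iso_graph L"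
  then show "(N, M) \<in> iso_graph L"
    by (cases "M \<in> range (point_structure L) \<or> N \<in> range (point_structure L)")
       (simp_all only: iso_graph_def mem_Collect_eq case_prod_conv if_True if_False de_Morgan_disj simp_thms,
        blast+)
qed

lemma iso_graph_subset:
  assumes "countable_language L"
  shows "iso_graph L \<subseteq> isomorphism_rel L"
proof clarify
  fix M N assume MN: "(M, N) \<in> iso_graph L"
  then have M: "M \<in> Mod L" "N \<in> Mod L" by (auto simp: iso_graph_def)
  show "(M, N) \<in> isomorphism_rel L"
  proof (cases "M \<in> range (point_structure L) \<or> N \<in> range (point_structure L)")
    case True
    then show ?thesis
      using MN point_structures_isomorphic[of L] by (auto simp: iso_graph_def)
  next
    case False
    then have "adjacent L M N \<or> adjacent L N M" using MN by (auto simp: iso_graph_def)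
    then show ?thesis
      using adjacent_isomorphic[OF assms] M equiv_isomorphism_rel[of L] by (meson equivE symD)
  qed
qed

lemma iso_graph_two_steps:
  assumes L: "countable_language L" and MN: "(M, N) \<in> isomorphism_rel L"
  shows "M = N \<or> (M, N) \<in> iso_graph L \<or> (\<exists>K. (M, K) \<in> iso_graph L \<and> (K, N) \<in> iso_graph L)"
proof -
  have Mod: "M \<in> Mod L" "N \<in> Mod L" using MN by (auto simp: isomorphism_rel_def)
  note iff = isomorphic_point_structure[OF L]
  show ?thesis
  proof (cases "M \<in> range (point_structure L)")
    case True
    then have N: "N \<in> range (point_structure L)" using iff[OF MN] by simp
    let ?Z = "point_structure L 0"
    have star: "(K, ?Z) \<in> iso_graph L" "(?Z, K) \<in> iso_graph L"
      if "K \<noteq> ?Z" "K \<in> range (point_structure L)" for K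
      using that point_structure_in_Mod[of L] by (auto simp: iso_graph_def)
    show ?thesis
      using star True N by metis
  next
    case False
    then have N: "N \<notin> range (point_structure L)" using iff[OF MN] by simp
    show ?thesis
      using isomorphic_adjacent[OF L MN]
    proof (elim disjE bexE)
      assume "adjacent L M N"
      then show ?thesis using False N Mod by (auto simp: iso_graph_def)
    next
      fix K assume K: "K \<in> Mod L" "adjacent L K M \<and> adjacent L K N"
      then have "K \<notin> range (point_structure L)"
        using adjacent_isomorphic[OF L] Mod False iff by blast
      \<comment> \<open>\<open>K\<close> may coincide with \<open>M\<close> or \<open>N\<close>; as
        loops are excluded, the path then becomes shorter.\<close>
      then have "K = M \<or> (M, K) \<in> iso_graph L" "K = N \<or> (K, N) \<in> iso_graph L"
        using K False N Mod by (auto simp: iso_graph_def)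
      then show ?thesis by blast
    qed
  qed
qed

lemma iso_graph_borel:
  assumes L: "countable_language L"
  shows "iso_graph L \<in> borel_sets_of (prod_topology (Mod_topology L) (Mod_topology L))"
proof -
  let ?S = "Mod_pair_measure L"
  have [measurable]: "Measurable.pred ?S (\<lambda>z. diag L (fst z) i xs)"
    "Measurable.pred ?S (\<lambda>z. diag L (snd z) i xs)" for i xs
    using pred_diag[OF L] by blast+
  have [measurable]: "Measurable.pred ?S (\<lambda>z. adjacent L (fst z) (snd z))"
    "Measurable.pred ?S (\<lambda>z. adjacent L (snd z) (fst z))"
    unfolding adjacent_def
    by (intro pred_intros_logic pred_finitary_iso pred_coded_iso; measurable)+
  \<comment> \<open>Equality of structures becomes countably many conditions on diagrams, so
    excluding loops and lying in the countable class are Borel conditions.\<close>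
  have eq: "M = N \<longleftrightarrow> (\<forall>i xs. diag L M i xs = diag L N i xs)" if "M \<in> Mod L" "N \<in> Mod L" for M N
    using diag_inject[OF L that] by blast
  let ?pt = "\<lambda>M. \<exists>k. \<forall>i xs. diag L M i xs = diag L (point_structure L k) i xs"
  have pt: "M \<in> range (point_structure L) \<longleftrightarrow> ?pt M" if "M \<in> Mod L" for M
    using eq[OF that point_structure_in_Mod] by blast
  have "iso_graph L = {z \<in> space ?S.
     \<not> (\<forall>i xs. diag L (fst z) i xs = diag L (snd z) i xs) \<and>
     (if ?pt (fst z) \<or> ?pt (snd z)
      then ?pt (fst z) \<and> ?pt (snd z) \<and>
        ((\<forall>i xs. diag L (fst z) i xs = diag L (point_structure L 0) i xs) \<or>
         (\<forall>i xs. diag L (snd z) i xs = diag L (point_structure L 0) i xs))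
      else adjacent L (fst z) (snd z) \<or> adjacent L (snd z) (fst z))}" (is "_ = ?G")
    unfolding iso_graph_def
    by (auto simp only: space_Mod_pair_measure mem_Sigma_iff fst_conv snd_conv pt
        eq[OF _ point_structure_in_Mod] eq cong: conj_cong split: prod.splits)
  also have "?G \<in> sets ?S" by measurable
  finally show ?thesis by (simp add: sets_Mod_pair_measure)
qed

theorem theorem3p2:
  fixes L :: "('r, 'f) language"
  assumes "countable_language L"
  shows "\<exists>G. borel_graphable_by (Mod_topology L) (isomorphism_rel L) G \<and>
             graph_diameter (Mod L) G \<le> 2 \<and>
             (\<not> propositional_language L \<longrightarrow> graph_diameter (Mod L) G = 2)"
proof (intro exI conjI impI)
  let ?G = "iso_graph L"
  note two = iso_graph_two_steps[OF assms]
  have conn: "connectedness_rel (Mod L) ?G = isomorphism_rel L"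
    by (rule connectedness_rel_eq[OF equiv_isomorphism_rel iso_graph_subset[OF assms] two])
  moreover have "irrefl ?G" by (auto simp: irrefl_def iso_graph_def)
  ultimately show "borel_graphable_by (Mod_topology L) (isomorphism_rel L) ?G"
    using iso_graph_borel[OF assms] sym_iso_graph[of L]
    by (simp add: borel_graphable_by_def borel_graph_on_def)
  show le: "graph_diameter (Mod L) ?G \<le> 2"
    by (rule graph_diameter_le_2[OF conn two])
  assume "\<not> propositional_language L"
  then have inj: "point_structure L j = point_structure L k \<longleftrightarrow> j = k" for j k
    using inj_point_structure by (metis injD)
  have "2 \<le> graph_diameter (Mod L) ?G"
  proof (rule graph_diameter_ge_2)
    \<comment> \<open>Two leaves of the star centred at \<open>point_structure L 0\<close>, distinct
      by injectivity and not joined by an edge.\<close>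
    show "(point_structure L 1, point_structure L 2) \<in> connectedness_rel (Mod L) ?G"
      unfolding conn by (rule point_structures_isomorphic)
  qed (auto simp: inj iso_graph_def)
  with le show "graph_diameter (Mod L) ?G = 2" by (rule antisym)
qed

end
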